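(* Let $B,C$ be finite-dimensional quantum systems, let $\rho^{BC}$ be a quantum state, and let $|\psi\rangle^{ABC}$ be a purification of $\rho^{BC}$ with finite-dimensional purifying system $A$; write $\psi^{ABC}=|\psi\rangle\langle\psi|^{ABC}$. Then the geometric entanglement satisfies $$E_g(\rho^{BC})\ \ge\ 1-\max_{X^{ABC}}\mathrm{Tr}\left[X^{ABC}\psi^{ABC}\right],$$ where the maximum is over all matrices $X^{ABC}$ on $ABC$ with $$X^{ABC}\ge 0,\quad X^{T_A}\ge 0,\quad X^{T_B}\ge 0,\quad X^{T_C}\ge 0,\quad X^A=\mathbb{1}_A .$$
   Context: $X^{T_A},X^{T_B},X^{T_C}$ are the partial transposes of $X^{ABC}$ with respect to $A$, $B$, $C$, and $X^A=\mathrm{Tr}_{BC}[X^{ABC}]$. Geometric entanglement: for a pure bipartite state $|\phi\rangle^{BC}$ with $\phi=|\phi\rangle\langle\phi|$, $E_g(\phi)=1-\max|\langle\chi|\phi\rangle|^2$, the maximum being over all normalized product vectors $|\chi\rangle=|\chi_1\rangle^B\otimes|\chi_2\rangle^C$. For a mixed state $\rho^{BC}$, $E_g(\rho^{BC})=\min\sum_i p_iE_g(\psi_i)$, the minimum being over all pure state decompositions $\rho^{BC}=\sum_i p_i|\psi_i\rangle\langle\psi_i|$ with probabilities $p_i$ and normalized $|\psi_i\rangle$. *)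

theory Defs
  imports "HOL-Analysis.Analysis"
begin

text \<open>
  A finite-dimensional quantum system is given by a finite index type \<open>'n\<close>, its Hilbert space being
  \<open>complex ^ 'n\<close> with the standard orthonormal basis. The composite of systems indexed by \<open>'b\<close>
  and \<open>'c\<close> is indexed by \<open>'b \<times> 'c\<close>, and \<open>ABC\<close> by \<open>'a \<times> 'b \<times> 'c\<close> (so that it is also \<open>A\<close> with
  \<open>BC\<close>). The entry of \<open>M\<close> in row \<open>i\<close> and column \<open>j\<close> is \<open>M $ i $ j\<close>.
  Transposes are taken in the standard basis.
\<close>

definition braket :: "complex ^ 'n \<Rightarrow> complex ^ 'n \<Rightarrow> complex" where
  "braket x y = (\<Sum>i\<in>UNIV. cnj (x $ i) * y $ i)"

definition proj :: "complex ^ 'n \<Rightarrow> complex ^ 'n ^ 'n" where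
  "proj x = (\<chi> i j. x $ i * cnj (x $ j))"

definition tensor_vec ::
  "complex ^ 'b \<Rightarrow>
   complex ^ 'c \<Rightarrow>
   complex ^ ('b::finite \<times> 'c::finite)" where
  "tensor_vec x y = (\<chi> p. x $ fst p * y $ snd p)"

definition dagger :: "complex ^ 'n ^ 'm \<Rightarrow> complex ^ 'm ^ 'n" where
  "dagger M = (\<chi> i j. cnj (M $ j $ i))"

definition psd :: "complex ^ 'n ^ 'n \<Rightarrow> bool" where
  "psd M \<longleftrightarrow> dagger M = M \<and> (\<forall>v. 0 \<le> Re (braket v (M *v v)))"

definition quantum_state :: "complex ^ 'n ^ 'n \<Rightarrow> bool" where
  "quantum_state \<rho> \<longleftrightarrow> psd \<rho> \<and> trace \<rho> = 1"

definition trace_out_fst ::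
  "complex ^ ('a::finite \<times> 's::finite) ^ ('a \<times> 's) \<Rightarrow> complex ^ 's ^ 's" where
  "trace_out_fst M = (\<chi> i j. \<Sum>k\<in>UNIV. M $ (k, i) $ (k, j))"

definition trace_out_snd ::
  "complex ^ ('a::finite \<times> 's::finite) ^ ('a \<times> 's) \<Rightarrow> complex ^ 'a ^ 'a" where
  "trace_out_snd M = (\<chi> i j. \<Sum>k\<in>UNIV. M $ (i, k) $ (j, k))"

definition ptranspose_A ::
  "complex ^ ('a::finite \<times> 'b::finite \<times> 'c::finite) ^ ('a \<times> 'b \<times> 'c) \<Rightarrow>
   complex ^ ('a \<times> 'b \<times> 'c) ^ ('a \<times> 'b \<times> 'c)" where
  "ptranspose_A M = (\<chi> p q. case (p, q) of ((a, b, c), (a', b', c')) \<Rightarrow> M $ (a', b, c) $ (a, b', c'))"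

definition ptranspose_B ::
  "complex ^ ('a::finite \<times> 'b::finite \<times> 'c::finite) ^ ('a \<times> 'b \<times> 'c) \<Rightarrow>
   complex ^ ('a \<times> 'b \<times> 'c) ^ ('a \<times> 'b \<times> 'c)" where
  "ptranspose_B M = (\<chi> p q. case (p, q) of ((a, b, c), (a', b', c')) \<Rightarrow> M $ (a, b', c) $ (a', b, c'))"

definition ptranspose_C ::
  "complex ^ ('a::finite \<times> 'b::finite \<times> 'c::finite) ^ ('a \<times> 'b \<times> 'c) \<Rightarrow>
   complex ^ ('a \<times> 'b \<times> 'c) ^ ('a \<times> 'b \<times> 'c)" where
  "ptranspose_C M = (\<chi> p q. case (p, q) of ((a, b, c), (a', b', c')) \<Rightarrow> M $ (a, b, c') $ (a', b', c))"

definition purification ::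
  "complex ^ ('a::finite \<times> 's::finite) \<Rightarrow> complex ^ 's ^ 's \<Rightarrow> bool" where
  "purification \<psi> \<rho> \<longleftrightarrow> norm \<psi> = 1 \<and> trace_out_fst (proj \<psi>) = \<rho>"

text \<open>
  The maximum over product vectors and the minimum over decompositions are attained (by compactness
  and by Caratheodory's theorem), so they are written as a supremum and an infimum in \<open>real\<close>.
\<close>

definition geom_ent_pure :: "complex ^ ('b::finite \<times> 'c::finite) \<Rightarrow> real" where
  "geom_ent_pure \<phi> =
     1 - Sup {(cmod (braket (tensor_vec x y) \<phi>))\<^sup>2 | x y. norm (tensor_vec x y) = 1}"

definition pure_state_decomposition ::
  "nat \<Rightarrow> (nat \<Rightarrow> real) \<Rightarrow> (nat \<Rightarrow> complex ^ 'n) \<Rightarrow> complex ^ 'n ^ 'n \<Rightarrow> bool" where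
  "pure_state_decomposition n p \<psi> \<rho> \<longleftrightarrow>
     (\<forall>i<n. 0 \<le> p i) \<and> (\<Sum>i<n. p i) = 1 \<and> (\<forall>i<n. norm (\<psi> i) = 1) \<and>
     \<rho> = (\<Sum>i<n. p i *\<^sub>R proj (\<psi> i))"

definition geom_ent ::
  "complex ^ ('b::finite \<times> 'c::finite) ^ ('b \<times> 'c) \<Rightarrow> real" where
  "geom_ent \<rho> =
     Inf {\<Sum>i<n. p i * geom_ent_pure (\<psi> i) | n p \<psi>. pure_state_decomposition n p \<psi> \<rho>}"

definition feasible :: "(complex ^ ('a::finite \<times> 'b::finite \<times> 'c::finite) ^ ('a \<times> 'b \<times> 'c)) set" where
  "feasible = {X. psd X \<and> psd (ptranspose_A X) \<and> psd (ptranspose_B X) \<and> psd (ptranspose_C X) \<and>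
                  trace_out_snd X = mat 1}"

end

theory Submission
  imports Defs
begin

text \<open>
  Every pure state decomposition of \<open>\<rho>\<close> into \<open>p\<^sub>i\<close>, \<open>\<phi>\<^sub>i\<close> is induced by a measurement of the purifying
  system: there are vectors \<open>m\<^sub>i\<close> of \<open>A\<close> with \<open>\<Sum>i. proj m\<^sub>i \<le> 1\<close> such that contracting \<open>\<psi>\<close> with
  \<open>m\<^sub>i\<close> leaves \<open>\<surd>p\<^sub>i \<phi>\<^sub>i\<close>. If \<open>\<chi>\<^sub>i\<close> is a product vector close to \<open>\<phi>\<^sub>i\<close>, then the fully separable
  operator \<open>X = \<Sum>i. proj m\<^sub>i \<otimes> proj \<chi>\<^sub>i + R \<otimes> proj \<chi>\<^sub>0\<close>, where \<open>R = 1 - \<Sum>i. proj m\<^sub>i\<close>, is feasible and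
  its value is at least the average squared overlap of \<open>\<chi>\<^sub>i\<close> with \<open>\<phi>\<^sub>i\<close>. The maximum is attained
  because the feasible set is compact: positivity bounds all entries of \<open>X\<close> by its diagonal, which
  \<open>X\<^sup>A = 1\<close> bounds by 1.
\<close>

section \<open>Inner products and rank-one operators\<close>

lemma sum_UNIV_prod:
  fixes f :: "'a::finite \<times> 'b::finite \<Rightarrow> 'c::comm_monoid_add"
  shows "(\<Sum>p\<in>UNIV. f p) = (\<Sum>a\<in>UNIV. \<Sum>b\<in>UNIV. f (a, b))"
  by (simp add: sum.cartesian_product flip: UNIV_Times_UNIV)

lemma Re_braket: "Re (braket x y) = x \<bullet> y"
  by (simp add: braket_def inner_vec_def inner_complex_def)

lemma braket_commute: "braket y x = cnj (braket x y)"
  by (simp add: braket_def mult.commute)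

lemma cmod_braket_commute: "cmod (braket y x) = cmod (braket x y)"
  by (simp add: braket_commute[of y x])

lemma braket_self: "braket x x = complex_of_real ((norm x)\<^sup>2)"
  by (rule complex_eqI)
     (simp_all add: Re_braket power2_norm_eq_inner, simp add: braket_def mult.commute)

lemma braket_add_right: "braket x (y + z) = braket x y + braket x z"
  by (simp add: braket_def sum.distrib distrib_left)

lemma braket_diff_right: "braket x (y - z) = braket x y - braket x z"
  by (simp add: braket_def sum_subtractf right_diff_distrib)

lemma braket_vector_scalar_right: "braket x (c *s y) = c * braket x y"
  by (simp add: braket_def sum_distrib_left algebra_simps)

lemma braket_vector_scalar_left: "braket (c *s x) y = cnj c * braket x y"
  by (simp add: braket_def sum_distrib_left algebra_simps)

lemma braket_sum_right: "braket x (\<Sum>i\<in>I. f i) = (\<Sum>i\<in>I. braket x (f i))"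
  by (simp add: braket_def sum_distrib_left) (rule sum.swap)

lemma braket_sum_left: "braket (\<Sum>i\<in>I. f i) y = (\<Sum>i\<in>I. braket (f i) y)"
  by (simp add: braket_def sum_distrib_right) (rule sum.swap)

lemma braket_axis_right: "braket x (axis j 1) = cnj (x $ j)"
  by (simp add: braket_def axis_def if_distrib cong: if_cong)

lemma braket_axis_left: "braket (axis j 1) y = y $ j"
  by (subst braket_commute) (simp add: braket_axis_right)

lemma braket_ext:
  assumes "\<And>z. braket x z = braket y z"
  shows "x = y"
  using assms[of "axis _ 1"] by (simp add: braket_axis_right vec_eq_iff)

lemma sum_matrix_vector_mult: "(\<Sum>i\<in>I. M i) *v v = (\<Sum>i\<in>I. M i *v v)"
  for M :: "'i \<Rightarrow> complex ^ 'n ^ 'm"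
  by (induction I rule: infinite_finite_induct) (simp_all add: matrix_vector_mult_add_rdistrib)

lemma proj_mult_vec: "proj u *v z = braket u z *s u"
  by (simp add: vec_eq_iff matrix_vector_mult_def proj_def braket_def
      sum_distrib_left sum_distrib_right mult_ac)

lemma proj_scaleR: "proj (c *\<^sub>R x) = c\<^sup>2 *\<^sub>R proj x"
  by (simp add: proj_def vec_eq_iff power2_eq_square scaleR_conv_of_real[where 'a = complex])

text \<open>The right side is a sum of nonnegative reals, so over a finite \<open>I\<close> a
  vanishing quadratic form forces \<open>z\<close> to be orthogonal to every
  \<open>f i\<close>.\<close>

lemma braket_sum_proj:
  "braket z ((\<Sum>i\<in>I. proj (f i)) *v z) = complex_of_real (\<Sum>i\<in>I. (cmod (braket (f i) z))\<^sup>2)"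
proof -
  have "braket z ((\<Sum>i\<in>I. proj (f i)) *v z) = (\<Sum>i\<in>I. braket (f i) z * braket z (f i))"
    by (simp add: sum_matrix_vector_mult proj_mult_vec braket_sum_right braket_vector_scalar_right)
  also have "\<dots> = (\<Sum>i\<in>I. complex_of_real ((cmod (braket (f i) z))\<^sup>2))"
    by (intro sum.cong refl, subst (2) braket_commute) (metis complex_norm_square of_real_power)
  finally show ?thesis by simp
qed

lemma trace_mult_proj: "trace (X ** proj \<psi>) = braket \<psi> (X *v \<psi>)"
  by (simp add: trace_def matrix_matrix_mult_def matrix_vector_mult_def braket_def proj_def
      sum_distrib_left mult_ac)

section \<open>Positive semidefinite matrices\<close>

lemma dagger_sum: "dagger (\<Sum>i\<in>I. M i) = (\<Sum>i\<in>I. dagger (M i))"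
  by (simp add: dagger_def vec_eq_iff)

lemma psd_sum:
  assumes "\<And>i. i \<in> I \<Longrightarrow> psd (M i)"
  shows "psd (\<Sum>i\<in>I. M i)"
  using assms
  by (auto simp: psd_def dagger_sum sum_matrix_vector_mult braket_sum_right intro!: sum_nonneg)

lemma psd_proj: "psd (proj x)"
proof -
  have "dagger (proj x) = proj x"
    by (simp add: dagger_def proj_def vec_eq_iff)
  then show ?thesis
    using braket_sum_proj[of _ "\<lambda>_. x" "{()}"] by (auto simp: psd_def)
qed

text \<open>The quadratic form of \<open>transpose M\<close> at \<open>v\<close> is that of
  \<open>M\<close> at the entrywise conjugate of \<open>v\<close>.\<close>

lemma psd_transpose:
  assumes "psd M"
  shows "psd (transpose M)"
proof -
  have "braket v (transpose M *v v) = braket (\<chi> i. cnj (v $ i)) (M *v (\<chi> i. cnj (v $ i)))" for v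
    unfolding braket_def matrix_vector_mult_def transpose_def
    by (simp add: sum_distrib_left, subst sum.swap) (simp add: mult_ac)
  moreover have "dagger (transpose M) = transpose M"
    using assms unfolding psd_def dagger_def transpose_def vec_eq_iff by simp
  ultimately show ?thesis
    using assms by (simp add: psd_def)
qed

section \<open>Product operators and their partial transposes\<close>

definition tensor_op ::
  "complex ^ 'a ^ 'a \<Rightarrow> complex ^ 's \<Rightarrow> complex ^ ('a::finite \<times> 's::finite) ^ ('a \<times> 's)" where
  "tensor_op M t = (\<chi> p q. M $ fst p $ fst q * proj t $ snd p $ snd q)"

text \<open>This is the contraction \<open>(1 \<otimes> <t|) v\<close>, a vector of the first
  system.\<close>

definition partial_braket ::
  "complex ^ 's \<Rightarrow> complex ^ ('a::finite \<times> 's::finite) \<Rightarrow> complex ^ 'a" where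
  "partial_braket t v = (\<chi> k. \<Sum>s\<in>UNIV. cnj (t $ s) * v $ (k, s))"

text \<open>\<open>tensor_op M t\<close> is \<open>M\<close> composed with the map sending
  \<open>a\<close> to \<open>a \<otimes> t\<close> on the left and its adjoint
  \<open>partial_braket t\<close> on the right. Positivity is thus inherited from
  \<open>M\<close>.\<close>

lemma braket_tensor_op:
  "braket v (tensor_op M t *v v) = braket (partial_braket t v) (M *v partial_braket t v)"
proof -
  have "(tensor_op M t *v v) $ (k, s) = t $ s * (M *v partial_braket t v) $ k" for k s
    by (simp add: matrix_vector_mult_def tensor_op_def partial_braket_def proj_def sum_UNIV_prod
        sum_distrib_left mult_ac)
  then have "braket v (tensor_op M t *v v)
      = (\<Sum>k\<in>UNIV. (\<Sum>s\<in>UNIV. t $ s * cnj (v $ (k, s))) * (M *v partial_braket t v) $ k)"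
    unfolding braket_def sum_UNIV_prod by (simp add: sum_distrib_left sum_distrib_right mult_ac)
  then show ?thesis
    by (simp add: braket_def[of "partial_braket t v"]) (simp add: partial_braket_def)
qed

lemma psd_tensor_op:
  assumes "psd M"
  shows "psd (tensor_op M t)"
proof -
  have "cnj (M $ j $ i) = M $ i $ j" for i j
    using assms unfolding psd_def dagger_def vec_eq_iff by simp
  then have "dagger (tensor_op M t) = tensor_op M t"
    by (simp add: dagger_def tensor_op_def vec_eq_iff proj_def)
  then show ?thesis
    using assms by (simp add: psd_def braket_tensor_op)
qed

lemma trace_out_snd_tensor_op:
  assumes "norm t = 1"
  shows "trace_out_snd (tensor_op M t) = M"
proof -
  have "(\<Sum>k\<in>UNIV. t $ k * cnj (t $ k)) = 1"
    using braket_self[of t] assms by (simp add: braket_def mult.commute)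
  then show ?thesis
    by (simp add: trace_out_snd_def tensor_op_def proj_def vec_eq_iff flip: sum_distrib_left)
qed

lemma ptranspose_A_tensor_op:
  "ptranspose_A (tensor_op M (tensor_vec x y)) = tensor_op (transpose M) (tensor_vec x y)"
  by (simp add: ptranspose_A_def tensor_op_def vec_eq_iff transpose_def)

text \<open>Transposing \<open>proj x\<close> amounts to conjugating the entries of
  \<open>x\<close>.\<close>

lemma ptranspose_B_tensor_op:
  "ptranspose_B (tensor_op M (tensor_vec x y)) = tensor_op M (tensor_vec (\<chi> i. cnj (x $ i)) y)"
  by (simp add: ptranspose_B_def tensor_op_def vec_eq_iff proj_def tensor_vec_def)

lemma ptranspose_C_tensor_op:
  "ptranspose_C (tensor_op M (tensor_vec x y)) = tensor_op M (tensor_vec x (\<chi> i. cnj (y $ i)))"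
  by (simp add: ptranspose_C_def tensor_op_def vec_eq_iff proj_def tensor_vec_def)

lemma ptranspose_sum:
  "ptranspose_A (\<Sum>i\<in>I. M i) = (\<Sum>i\<in>I. ptranspose_A (M i))"
  "ptranspose_B (\<Sum>i\<in>I. M i) = (\<Sum>i\<in>I. ptranspose_B (M i))"
  "ptranspose_C (\<Sum>i\<in>I. M i) = (\<Sum>i\<in>I. ptranspose_C (M i))"
  by (simp_all add: ptranspose_A_def ptranspose_B_def ptranspose_C_def vec_eq_iff)

lemma trace_out_snd_sum: "trace_out_snd (\<Sum>i\<in>I. M i) = (\<Sum>i\<in>I. trace_out_snd (M i))"
  by (simp add: trace_out_snd_def vec_eq_iff) (intro allI sum.swap)

text \<open>A partial transpose acts on a single tensor factor, so it turns each product term into a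
  product term that is again positive. The unit vectors drop out of the trace over BC, which leaves
  the sum of the \<open>M i\<close>.\<close>

lemma separable_feasible:
  assumes "\<And>i. i \<in> I \<Longrightarrow> psd (M i)"
    and "\<And>i. i \<in> I \<Longrightarrow> norm (tensor_vec (x i) (y i)) = 1"
    and "(\<Sum>i\<in>I. M i) = mat 1"
  shows "(\<Sum>i\<in>I. tensor_op (M i) (tensor_vec (x i) (y i))) \<in> feasible"
  using assms
  by (simp add: feasible_def ptranspose_sum trace_out_snd_sum trace_out_snd_tensor_op
      psd_sum psd_tensor_op psd_transpose ptranspose_A_tensor_op ptranspose_B_tensor_op
      ptranspose_C_tensor_op cong: sum.cong)

lemma norm_tensor_vec: "norm (tensor_vec x y) = norm x * norm y"
proof -
  have "(norm (tensor_vec x y))\<^sup>2 = (norm x * norm y)\<^sup>2"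
    by (simp add: norm_vec_def L2_set_def sum_nonneg sum_UNIV_prod tensor_vec_def norm_mult
        power_mult_distrib sum_product)
  then show ?thesis
    by (simp add: power2_eq_iff_nonneg)
qed

lemma exists_unit_tensor_vec: "\<exists>x y. norm (tensor_vec x y) = 1"
  by (rule exI[of _ "axis undefined 1"], rule exI[of _ "axis undefined 1"])
     (simp add: norm_tensor_vec)

section \<open>Compactness of the feasible set and existence of the maximum\<close>

lemma matrix_vector_mult_axis: "M *v axis k 1 = column k M"
  for M :: "complex ^ 'n ^ 'm"
  by (simp add: vec_eq_iff matrix_vector_mult_def column_def axis_def if_distrib cong: if_cong)

lemma psd_diag_nonneg:
  assumes "psd M"
  shows "0 \<le> Re (M $ p $ p)"
proof -
  have "braket (axis p 1) (M *v axis p 1) = M $ p $ p"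
    by (simp add: braket_axis_left matrix_vector_mult_axis column_def)
  then show ?thesis
    using assms by (metis psd_def)
qed

text \<open>The quadratic form is tested at \<open>axis p 1 + z *s axis q 1\<close> for the four
  phases \<open>z\<close>. The bound is crude but suffices for boundedness.\<close>

lemma psd_entry_le:
  assumes "psd M"
  shows "cmod (M $ p $ q) \<le> Re (M $ p $ p) + Re (M $ q $ q)"
proof -
  have herm: "M $ q $ p = cnj (M $ p $ q)"
    using assms unfolding psd_def dagger_def vec_eq_iff by (metis vec_lambda_beta)
  have "0 \<le> Re (M $ p $ p) + Re (M $ q $ q) + 2 * Re (z * M $ p $ q)" if "cnj z * z = 1" for z
  proof -
    define v where "v = axis p 1 + z *s axis q 1"
    have "braket v w = braket (axis p 1) w + cnj z * braket (axis q 1) w" for w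
      unfolding v_def
      by (simp add: braket_def sum.distrib distrib_right distrib_left sum_distrib_left mult_ac)
    moreover have "M *v v = column p M + z *s column q M"
      unfolding v_def
      by (simp add: matrix_vector_right_distrib matrix_vector_mult_axis vector_scalar_commute)
    ultimately have "braket v (M *v v)
        = M $ p $ p + z * M $ p $ q + cnj z * M $ q $ p + (cnj z * z) * M $ q $ q"
      by (simp add: braket_add_right braket_vector_scalar_right braket_axis_left column_def algebra_simps)
    moreover have "0 \<le> Re (braket v (M *v v))"
      using assms by (simp add: psd_def)
    ultimately show ?thesis
      by (simp add: that herm)
  qed
  \<comment> \<open>The phases 1 and -1 bound twice the absolute real part of the entry, the
    imaginary phases twice its absolute imaginary part.\<close>
  from this[of 1] this[of "-1"] this[of \<i>] this[of "-\<i>"]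
  show ?thesis
    using cmod_le[of "M $ p $ q"] by simp
qed

lemma continuous_on_trace_out_snd [continuous_intros]:
  "continuous_on S f \<Longrightarrow> continuous_on S (\<lambda>x. trace_out_snd (f x))"
  unfolding trace_out_snd_def by (intro continuous_intros)

text \<open>Positivity is an intersection of closed conditions, one for each entry or test vector.
  The map \<open>f\<close> lets this cover \<open>X\<close> and all its partial transposes.\<close>

lemma closed_psd_vimage:
  assumes "\<And>i j. continuous_on UNIV (\<lambda>x. f x $ i $ j)"
  shows "closed {x. psd (f x)}"
proof -
  have "{x. psd (f x)} = (\<Inter>i j. {x. cnj (f x $ j $ i) = f x $ i $ j}) \<inter>
      (\<Inter>v. {x. 0 \<le> Re (braket v (f x *v v))})"
    by (auto simp: psd_def dagger_def vec_eq_iff)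
  also have "closed \<dots>"
    unfolding braket_def matrix_vector_mult_def vec_lambda_beta
    by (intro closed_Int closed_INT ballI closed_Collect_eq closed_Collect_le continuous_intros assms)
  finally show ?thesis .
qed

lemma closed_feasible: "closed feasible"
proof -
  have "feasible = {X. psd X} \<inter> {X. psd (ptranspose_A X)} \<inter> {X. psd (ptranspose_B X)} \<inter>
      {X. psd (ptranspose_C X)} \<inter> {X. trace_out_snd X = mat 1}"
    by (auto simp: feasible_def)
  also have "closed \<dots>"
    unfolding ptranspose_A_def ptranspose_B_def ptranspose_C_def
    by (intro closed_Int closed_psd_vimage closed_Collect_eq continuous_intros)
       (auto simp: split_beta intro!: continuous_intros)
  finally show ?thesis .
qed

text \<open>A diagonal entry of \<open>X\<close> is one of the nonnegative summands of a diagonal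
  entry of the reduced matrix, which is 1; two such bounds add up to 2.\<close>

lemma feasible_entry_le:
  assumes "X \<in> feasible"
  shows "cmod (X $ p $ q) \<le> 2"
proof -
  have psd: "psd X" and tr: "trace_out_snd X = mat 1"
    using assms by (auto simp: feasible_def)
  have "Re (X $ r $ r) \<le> 1" for r
  proof -
    obtain a s where r: "r = (a, s)" by (rule prod.exhaust)
    have "Re (X $ r $ r) \<le> (\<Sum>k\<in>UNIV. Re (X $ (a, k) $ (a, k)))"
      unfolding r by (rule member_le_sum) (auto simp: psd_diag_nonneg psd)
    also have "\<dots> = Re (trace_out_snd X $ a $ a)"
      by (simp add: trace_out_snd_def)
    finally show ?thesis by (simp add: tr mat_def)
  qed
  from this[of p] this[of q] psd_entry_le[OF psd, of p q] show ?thesis by linarith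
qed

lemma compact_feasible: "compact feasible"
proof -
  have "norm X \<le>
      (\<Sum>p\<in>(UNIV :: ('a \<times> 'b \<times> 'c) set). \<Sum>q\<in>(UNIV :: ('a \<times> 'b \<times> 'c) set). 2)"
    if "X \<in> feasible" for X :: "complex ^ ('a \<times> 'b \<times> 'c) ^ ('a \<times> 'b \<times> 'c)"
  proof -
    have "norm (X $ p) \<le> (\<Sum>q\<in>(UNIV :: ('a \<times> 'b \<times> 'c) set). 2)" for p
      unfolding norm_vec_def
      by (intro order_trans[OF L2_set_le_sum] sum_mono feasible_entry_le that norm_ge_zero)
    then show ?thesis
      unfolding norm_vec_def[of X]
      by (intro order_trans[OF L2_set_le_sum] sum_mono) auto
  qed
  then show ?thesis
    unfolding compact_eq_bounded_closed bounded_iff using closed_feasible by blast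
qed

lemma feasible_nonempty: "feasible \<noteq> {}"
proof -
  obtain x :: "complex ^ 'b" and y :: "complex ^ 'c" where "norm (tensor_vec x y) = 1"
    using exists_unit_tensor_vec by blast
  moreover have "psd (mat 1 :: complex ^ 'a ^ 'a)"
    by (simp add: psd_def dagger_def mat_def vec_eq_iff)
       (simp add: Re_braket flip: mat_def)
  ultimately have "(\<Sum>i\<in>{()}. tensor_op (mat 1 :: complex ^ 'a ^ 'a) (tensor_vec x y)) \<in> feasible"
    by (intro separable_feasible) auto
  then show ?thesis by blast
qed

lemma feasible_max:
  obtains X where "X \<in> feasible"
    and "\<And>Y. Y \<in> feasible \<Longrightarrow> Re (trace (Y ** proj \<psi>)) \<le> Re (trace (X ** proj \<psi>))"
proof -
  have "continuous_on feasible (\<lambda>X. Re (trace (X ** proj \<psi>)))"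
    unfolding trace_mult_proj braket_def matrix_vector_mult_def vec_lambda_beta
    by (intro continuous_intros)
  then show ?thesis
    using continuous_attains_sup[OF compact_feasible feasible_nonempty] that by blast
qed

section \<open>Measurements inducing a given decomposition\<close>

lemma vector_in_range_sum_proj:
  fixes u :: "'k \<Rightarrow> complex ^ 's"
  assumes "finite K" "k \<in> K"
  shows "\<exists>s. (\<Sum>k\<in>K. proj (u k)) *v s = u k"
proof -
  \<comment> \<open>The component \<open>z\<close> of \<open>u k\<close> orthogonal to the range satisfies \<open>\<langle>z, \<rho> z\<rangle> = 0\<close>, so \<open>z\<close> is also
    orthogonal to \<open>u k\<close> and vanishes. The real inner product suffices for this.\<close>
  define \<rho> where "\<rho> = (\<Sum>k\<in>K. proj (u k))"
  have "subspace (range ((*v) \<rho>))"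
    by (intro linear_subspace_image matrix_vector_mul_linear subspace_UNIV)
  then have span: "span (range ((*v) \<rho>)) = range ((*v) \<rho>)"
    by (rule span_eq_iff[THEN iffD2])
  obtain y z where y: "y \<in> span (range ((*v) \<rho>))"
    and z: "\<And>w. w \<in> span (range ((*v) \<rho>)) \<Longrightarrow> orthogonal z w" and u: "u k = y + z"
    using orthogonal_subspace_decomp_exists by metis
  have "Re (braket z (\<rho> *v z)) = 0"
    using z[of "\<rho> *v z"] by (simp add: Re_braket span orthogonal_def)
  then have "\<forall>k\<in>K. (cmod (braket (u k) z))\<^sup>2 = 0"
    using assms by (simp add: \<rho>_def braket_sum_proj sum_nonneg_eq_0_iff)
  then have "u k \<bullet> z = 0"
    using assms by (simp flip: Re_braket)
  moreover have "y \<bullet> z = 0"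
    using z[OF y] by (simp add: orthogonal_def inner_commute)
  ultimately have "z = 0"
    using u by (simp add: inner_add_left)
  then show ?thesis
    using u y by (auto simp: span image_iff simp flip: \<rho>_def)
qed

text \<open>Two decompositions of one operator are related by a contraction. The \<open>m i\<close>
  need not sum to the identity: when the \<open>u k\<close> are linearly dependent, part of A is
  left over.\<close>

lemma measurement_inducing_decomposition:
  fixes u :: "'a::finite \<Rightarrow> complex ^ 's" and \<phi> :: "'i \<Rightarrow> complex ^ 's"
  assumes "finite I" and eq: "(\<Sum>k\<in>UNIV. proj (u k)) = (\<Sum>i\<in>I. proj (\<phi> i))"
  obtains m :: "'i \<Rightarrow> complex ^ 'a"
  where "psd (mat 1 - (\<Sum>i\<in>I. proj (m i)))"
    and "\<And>i. i \<in> I \<Longrightarrow> (\<Sum>k\<in>UNIV. cnj (m i $ k) *s u k) = \<phi> i"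
proof -
  define \<rho> where "\<rho> = (\<Sum>k\<in>UNIV. proj (u k))"
  have \<rho>_mult: "\<rho> *v z = (\<Sum>k\<in>UNIV. braket (u k) z *s u k)" for z
    by (simp add: \<rho>_def sum_matrix_vector_mult proj_mult_vec)
  have \<rho>_sum: "\<rho> *v (\<Sum>k\<in>UNIV. c k *s f k) = (\<Sum>k\<in>UNIV. c k *s (\<rho> *v f k))"
    for c and f :: "'a \<Rightarrow> complex ^ 's"
    by (simp add: vec.linear_sum[OF matrix_vector_mul_linear_gen] vector_scalar_commute)
  obtain s where s: "\<And>k. \<rho> *v s k = u k"
    using vector_in_range_sum_proj[OF finite, of _ UNIV u] unfolding \<rho>_def by (metis UNIV_I)
  \<comment> \<open>The \<open>s k\<close> act as images of the \<open>u k\<close> under a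
    generalized inverse of \<open>\<rho>\<close>, so these are the coefficients that express
    \<open>\<phi> i\<close> through the \<open>u k\<close>.\<close>
  define m where "m i = (\<chi> k. braket (\<phi> i) (s k))" for i
  have "(\<Sum>k\<in>UNIV. cnj (m i $ k) *s u k) = \<phi> i" if "i \<in> I" for i
  proof (rule braket_ext)
    fix z
    \<comment> \<open>Both terms of \<open>d\<close> have the same image under
      \<open>\<rho>\<close>, so \<open>d\<close> lies in its kernel and is orthogonal to every
      \<open>\<phi> i\<close>.\<close>
    define d where "d = (\<Sum>k\<in>UNIV. braket (u k) z *s s k) - z"
    have "\<rho> *v d = 0"
      by (simp add: d_def matrix_vector_mult_diff_distrib \<rho>_sum s) (simp add: \<rho>_mult)
    then have "braket d (\<rho> *v d) = 0"
      by (simp add: braket_def)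
    then have "(\<Sum>i\<in>I. (cmod (braket (\<phi> i) d))\<^sup>2) = 0"
      unfolding \<rho>_def eq braket_sum_proj of_real_eq_0_iff .
    then have "braket (\<phi> i) d = 0"
      using that assms by (simp add: sum_nonneg_eq_0_iff)
    then show "braket (\<Sum>k\<in>UNIV. cnj (m i $ k) *s u k) z = braket (\<phi> i) z"
      by (simp add: d_def m_def braket_diff_right braket_sum_right braket_sum_left
          braket_vector_scalar_right braket_vector_scalar_left mult.commute)
  qed
  moreover have "psd (mat 1 - (\<Sum>i\<in>I. proj (m i)))"
    unfolding psd_def
  proof safe
    show "dagger (mat 1 - (\<Sum>i\<in>I. proj (m i))) = mat 1 - (\<Sum>i\<in>I. proj (m i))"
      by (simp add: dagger_def vec_eq_iff mat_def proj_def mult.commute)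
  next
    fix v :: "complex ^ 'a"
    define c where "c = (\<Sum>k\<in>UNIV. cnj (v $ k) *s s k)"
    define w where "w = (\<chi> k. braket c (u k))"
    \<comment> \<open>\<open>\<langle>c, \<rho> c\<rangle>\<close> is both \<open>\<langle>v, w\<rangle>\<close> and \<open>\<parallel>w\<parallel>\<^sup>2\<close>, hence at most \<open>\<parallel>v\<parallel>\<^sup>2\<close>.\<close>
    have \<rho>c: "\<rho> *v c = (\<Sum>k\<in>UNIV. cnj (v $ k) *s u k)"
      by (simp add: c_def \<rho>_sum s)
    have "braket (m i) v = braket c (\<phi> i)" for i
      by (simp add: m_def c_def braket_def[of "\<chi> k. _ k"] braket_sum_left braket_vector_scalar_left
          braket_commute[of "\<phi> i"] mult.commute)
    then have "Re (braket v ((\<Sum>i\<in>I. proj (m i)) *v v)) = Re (braket c (\<rho> *v c))"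
      unfolding \<rho>_def eq braket_sum_proj by (simp add: cmod_braket_commute[of c])
    moreover have "Re (braket c (\<rho> *v c)) = v \<bullet> w"
      unfolding \<rho>c by (simp add: braket_sum_right braket_vector_scalar_right w_def
          braket_def[of v] flip: Re_braket)
    moreover have "Re (braket c (\<rho> *v c)) = (norm w)\<^sup>2"
      unfolding \<rho>_def braket_sum_proj
      by (simp add: cmod_braket_commute[of c] w_def norm_vec_def L2_set_def sum_nonneg)
    \<comment> \<open>Given \<open>v \<bullet> w = (norm w)\<^sup>2\<close>, expanding this square
      yields \<open>v \<bullet> w \<le> v \<bullet> v\<close>.\<close>
    moreover have "0 \<le> (norm (v - w))\<^sup>2" by simp
    then have "0 \<le> (norm v)\<^sup>2 - 2 * (v \<bullet> w) + (norm w)\<^sup>2"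
      by (simp add: power2_norm_eq_inner inner_diff inner_commute)
    ultimately have "Re (braket v ((\<Sum>i\<in>I. proj (m i)) *v v)) \<le> v \<bullet> v"
      by (simp add: power2_norm_eq_inner)
    then show "0 \<le> Re (braket v ((mat 1 - (\<Sum>i\<in>I. proj (m i))) *v v))"
      by (simp add: matrix_vector_mult_diff_rdistrib braket_diff_right Re_braket)
  qed
  ultimately show ?thesis using that by blast
qed

section \<open>Slices of the purification\<close>

text \<open>The unnormalized state of BC left when A is found in basis state
  \<open>k\<close>.\<close>

definition slice :: "complex ^ ('a::finite \<times> 's::finite) \<Rightarrow> 'a \<Rightarrow> complex ^ 's" where
  "slice \<psi> k = (\<chi> s. \<psi> $ (k, s))"

lemma trace_out_fst_proj: "trace_out_fst (proj \<psi>) = (\<Sum>k\<in>UNIV. proj (slice \<psi> k))"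
  by (simp add: trace_out_fst_def proj_def slice_def vec_eq_iff)

lemma norm_slices: "(\<Sum>k\<in>UNIV. (norm (slice \<psi> k))\<^sup>2) = (norm \<psi>)\<^sup>2"
  by (simp add: norm_vec_def L2_set_def sum_nonneg slice_def sum_UNIV_prod)

text \<open>The contractions of \<open>\<psi>\<close> with \<open>t\<close> on BC and with
  \<open>m\<close> on A commute. This turns the value of a product term into an overlap of
  \<open>t\<close> with the vector that \<open>m\<close> induces on BC.\<close>

lemma braket_partial_braket:
  "braket m (partial_braket t \<psi>) = braket t (\<Sum>k\<in>UNIV. cnj (m $ k) *s slice \<psi> k)"
  unfolding braket_sum_right braket_vector_scalar_right
  by (simp add: braket_def partial_braket_def slice_def)

text \<open>Needed because the infimum of the empty set is a junk value in \<open>real\<close>.\<close>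

lemma pure_state_decomposition_exists:
  assumes "purification \<psi> \<rho>"
  shows "\<exists>n p \<phi>. pure_state_decomposition n p \<phi> \<rho>"
proof -
  let ?A = "UNIV :: 'a set"
  obtain h where h: "bij_betw h {0..<card ?A} ?A"
    using ex_bij_betw_nat_finite[of ?A] by auto
  then have reindex: "(\<Sum>i<card ?A. f (h i)) = (\<Sum>k\<in>UNIV. f k)"
    for f :: "'a \<Rightarrow> 'z::comm_monoid_add"
    unfolding lessThan_atLeast0 by (rule sum.reindex_bij_betw)
  \<comment> \<open>A zero slice has weight 0, so any unit vector may stand in for its
    direction.\<close>
  define e :: "'a \<Rightarrow> complex ^ 'b" where
    "e k = (if slice \<psi> k = 0 then axis undefined 1 else sgn (slice \<psi> k))" for k
  have norm_e: "norm (e k) = 1" for k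
    by (simp add: e_def norm_sgn)
  have "slice \<psi> k = norm (slice \<psi> k) *\<^sub>R e k" for k
    by (simp add: e_def sgn_div_norm)
  then have proj_e: "proj (slice \<psi> k) = (norm (slice \<psi> k))\<^sup>2 *\<^sub>R proj (e k)" for k
    by (metis proj_scaleR)
  have "pure_state_decomposition (card ?A) (\<lambda>i. (norm (slice \<psi> (h i)))\<^sup>2) (\<lambda>i. e (h i)) \<rho>"
    using assms
    by (simp add: pure_state_decomposition_def purification_def norm_e norm_slices proj_e
        trace_out_fst_proj reindex[of "\<lambda>k. (norm (slice \<psi> k))\<^sup>2"]
        reindex[of "\<lambda>k. (norm (slice \<psi> k))\<^sup>2 *\<^sub>R proj (e k)"])
  then show ?thesis by blast
qed

section \<open>From product overlaps to the bound on the entanglement\<close>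

lemma feasible_attaining_overlaps:
  fixes \<psi> :: "complex ^ ('a::finite \<times> 'b::finite \<times> 'c::finite)"
  assumes "purification \<psi> \<rho>" and dec: "pure_state_decomposition n p \<phi> \<rho>"
    and unit: "\<And>i. i < n \<Longrightarrow> norm (tensor_vec (x i) (y i)) = 1"
  shows "\<exists>X\<in>feasible. (\<Sum>i<n. p i * (cmod (braket (tensor_vec (x i) (y i)) (\<phi> i)))\<^sup>2)
           \<le> Re (trace (X ** proj \<psi>))"
proof -
  have p: "0 \<le> p i" if "i < n" for i
    using dec that by (simp add: pure_state_decomposition_def)
  have "(\<Sum>k\<in>UNIV. proj (slice \<psi> k)) = (\<Sum>i<n. proj (sqrt (p i) *\<^sub>R \<phi> i))"
    using assms
    by (simp add: pure_state_decomposition_def purification_def trace_out_fst_proj proj_scaleR)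
  then obtain m :: "nat \<Rightarrow> complex ^ 'a" where psd: "psd (mat 1 - (\<Sum>i<n. proj (m i)))"
    and m: "\<And>i. i < n \<Longrightarrow> (\<Sum>k\<in>UNIV. cnj (m i $ k) *s slice \<psi> k) = sqrt (p i) *\<^sub>R \<phi> i"
    by (rule measurement_inducing_decomposition[OF finite_lessThan]) auto
  obtain x0 :: "complex ^ 'b" and y0 :: "complex ^ 'c" where unit0: "norm (tensor_vec x0 y0) = 1"
    using exists_unit_tensor_vec by blast
  \<comment> \<open>Index \<open>n\<close> carries the unmeasured remainder of the identity, paired
    with an arbitrary product vector; hence the sum up to \<open>Suc n\<close> in \<open>X\<close>.
    Its contribution to the value is nonnegative.\<close>
  define M where "M i = (if i < n then proj (m i) else mat 1 - (\<Sum>i<n. proj (m i)))" for i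
  define x' where "x' i = (if i < n then x i else x0)" for i
  define y' where "y' i = (if i < n then y i else y0)" for i
  define t where "t i = tensor_vec (x' i) (y' i)" for i
  define X where "X = (\<Sum>i<Suc n. tensor_op (M i) (t i))"
  have psd_M: "psd (M i)" for i
    by (simp add: M_def psd psd_proj)
  have "X \<in> feasible"
    unfolding X_def t_def
    by (rule separable_feasible) (auto simp: psd_M x'_def y'_def unit unit0, simp add: M_def)
  moreover have "p i * (cmod (braket (tensor_vec (x i) (y i)) (\<phi> i)))\<^sup>2
      = Re (braket \<psi> (tensor_op (M i) (t i) *v \<psi>))" if "i < n" for i
  proof -
    have "braket (m i) (partial_braket (t i) \<psi>) = sqrt (p i) * braket (t i) (\<phi> i)"
      unfolding braket_partial_braket m[OF that]
      by (simp add: braket_def sum_distrib_left scaleR_conv_of_real[where 'a = complex] mult_ac)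
    then have "(cmod (braket (m i) (partial_braket (t i) \<psi>)))\<^sup>2 = p i * (cmod (braket (t i) (\<phi> i)))\<^sup>2"
      using p[OF that] by (simp add: norm_mult power_mult_distrib)
    then show ?thesis
      using that braket_sum_proj[of "partial_braket (t i) \<psi>" m "{i}"]
      by (simp add: braket_tensor_op M_def t_def x'_def y'_def)
  qed
  moreover have "0 \<le> Re (braket \<psi> (tensor_op (M n) (t n) *v \<psi>))"
    using psd_tensor_op[OF psd_M, of n "t n"] by (simp add: psd_def)
  ultimately show ?thesis
    by (intro bexI[of _ X])
       (simp_all add: trace_mult_proj X_def sum_matrix_vector_mult matrix_vector_mult_add_rdistrib
         braket_add_right braket_sum_right)
qed

theorem mainTheorem6:
  fixes \<rho> :: "complex ^ ('b::finite \<times> 'c::finite) ^ ('b \<times> 'c)"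
    and \<psi> :: "complex ^ ('a::finite \<times> 'b \<times> 'c)"
  assumes "quantum_state \<rho>"
    and "purification \<psi> \<rho>"
  shows "\<exists>X \<in> feasible. (\<forall>Y \<in> feasible. Re (trace (Y ** proj \<psi>)) \<le> Re (trace (X ** proj \<psi>))) \<and>
           geom_ent \<rho> \<ge> 1 - Re (trace (X ** proj \<psi>))"
proof -
  obtain X where X: "X \<in> feasible"
    and max: "\<And>Y. Y \<in> feasible \<Longrightarrow> Re (trace (Y ** proj \<psi>)) \<le> Re (trace (X ** proj \<psi>))"
    using feasible_max by blast
  have "1 - Re (trace (X ** proj \<psi>)) \<le> (\<Sum>i<n. p i * geom_ent_pure (\<phi> i))"
    if dec: "pure_state_decomposition n p \<phi> \<rho>" for n p and \<phi> :: "nat \<Rightarrow> complex ^ ('b \<times> 'c)"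
  \<comment> \<open>The slack \<open>e\<close> allows product vectors that only come close to the
    supremum in \<open>geom_ent_pure\<close>.\<close>
  proof (rule field_le_epsilon)
    fix e :: real
    assume "0 < e"
    have p: "\<And>i. i < n \<Longrightarrow> 0 \<le> p i" "sum p {..<n} = 1"
      using dec by (auto simp: pure_state_decomposition_def)
    have "\<exists>x y. norm (tensor_vec x y) = 1 \<and>
        1 - geom_ent_pure (\<phi> i) - e < (cmod (braket (tensor_vec x y) (\<phi> i)))\<^sup>2" for i
    proof -
      let ?S = "{(cmod (braket (tensor_vec x y) (\<phi> i)))\<^sup>2 | x y. norm (tensor_vec x y) = 1}"
      have "1 - geom_ent_pure (\<phi> i) - e < Sup ?S"
        using \<open>0 < e\<close> by (simp add: geom_ent_pure_def)
      moreover have "?S \<noteq> {}"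
        using exists_unit_tensor_vec by blast
      ultimately obtain r where "r \<in> ?S" "1 - geom_ent_pure (\<phi> i) - e < r"
        by (rule less_cSupE)
      then show ?thesis by blast
    qed
    then obtain x y where unit: "\<And>i. norm (tensor_vec (x i) (y i)) = 1"
      and near: "\<And>i. 1 - geom_ent_pure (\<phi> i) - e < (cmod (braket (tensor_vec (x i) (y i)) (\<phi> i)))\<^sup>2"
      by metis
    \<comment> \<open>The weights sum to 1, so 1 and \<open>e\<close> may be averaged along with the
      entanglement.\<close>
    have "1 - (\<Sum>i<n. p i * geom_ent_pure (\<phi> i)) - e = (\<Sum>i<n. p i * (1 - geom_ent_pure (\<phi> i) - e))"
      by (simp add: right_diff_distrib sum_subtractf p flip: sum_distrib_right)
    also have "\<dots> \<le> (\<Sum>i<n. p i * (cmod (braket (tensor_vec (x i) (y i)) (\<phi> i)))\<^sup>2)"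
      by (intro sum_mono mult_left_mono less_imp_le[OF near] p) auto
    also have "\<dots> \<le> Re (trace (X ** proj \<psi>))"
      using feasible_attaining_overlaps[OF assms(2) dec, of x y] unit max by force
    finally show "1 - Re (trace (X ** proj \<psi>)) \<le> (\<Sum>i<n. p i * geom_ent_pure (\<phi> i)) + e"
      by simp
  qed
  then have "1 - Re (trace (X ** proj \<psi>)) \<le> geom_ent \<rho>"
    unfolding geom_ent_def
    using pure_state_decomposition_exists[OF assms(2)] by (intro cInf_greatest) blast+
  then show ?thesis
    using X max by blast
qed

end
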